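(* Let $\boldsymbol{\gamma}=(\gamma_j)_{j\ge1}$ be a sequence of positive coordinate weights at most one and let $q\in(1,\infty)$. Consider integration over the unit cube $[0,1]^d$ in the $d$-fold tensor product $F_d$ of the spaces $(P_2,\|\cdot\|_{q,\gamma_j})$, $j=1,\ldots,d$. Put $$\rho_q:=\frac{u_q}{12}-(2u_q)^q\,\frac{q+2}{q+1},$$ with some positive number $u_q$ that is strictly less than $\left(\frac{1}{12\cdot2^q}\,\frac{q+1}{q+2}\right)^{1/(q-1)}$. Then $\rho_q>0$ and $$N(\varepsilon,d)\ge(1-2\varepsilon)\prod_{j=1}^d\big(1+\gamma_j^{1/(q-1)}\rho_q\big)^{1/q}\qquad\text{for all }\varepsilon\in\left(0,\tfrac12\right)\text{ and }d\in\mathbb{N}.$$ In particular, for integration with positive rules: (i) strong polynomial tractability implies $\sum_{j=1}^\infty\gamma_j^{1/(q-1)}<\infty$; (ii) polynomial tractability implies $\limsup_{d\to\infty}\frac{1}{\log d}\sum_{j=1}^d\gamma_j^{1/(q-1)}<\infty$; (iii) weak tractability implies $\lim_{d\to\infty}\frac1d\sum_{j=1}^d\gamma_j^{1/(q-1)}=0$.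
   Context: $P_2$ is the space of all real polynomials of degree at most $2$, as functions on $[0,1]$. For $\gamma>0$ and $q\in(1,\infty)$ it is equipped with the norm $$\|f\|_{q,\gamma}=\Big(\|f\|_{L_q}^q+\frac1\gamma\big(\|f'\|_{L_q}^q+\|f''\|_{L_q}^q\big)\Big)^{1/q},$$ where $L_q=L_q([0,1])$. The tensor product $F_d$ of $(P_2,\|\cdot\|_{q,\gamma_1}),\ldots,(P_2,\|\cdot\|_{q,\gamma_d})$ consists of the real polynomials on $[0,1]^d$ of degree at most $2$ in each variable, equipped with a crossnorm $\|\cdot\|_d$, i.e. $\|f\|_d=\prod_{j=1}^d\|f_j\|_{q,\gamma_j}$ for $f(\boldsymbol{x})=f_1(x_1)\cdots f_d(x_d)$. It is a standing assumption that the tensor product of the univariate worst-case functions, i.e. the constant function $1$, is a worst-case function in $F_d$, so that the initial error $e(0,d)=\sup_{\|f\|_d\le1}|I_d(f)|$ equals $1$. Let $I_d(f)=\int_{[0,1]^d}f(\boldsymbol{x})\,\mathrm{d}\boldsymbol{x}$. Positive rules are $A_{d,N}(f)=\sum_{k=1}^Na_kf(\boldsymbol{x}_k)$ with $\boldsymbol{x}_k\in[0,1]^d$, $a_k\ge0$; their worst-case error is $\sup_{f\in F_d,\,\|f\|_d\le1}|I_d(f)-A_{d,N}(f)|$. Let $e(N,d)$ be the minimum (understood as an infimum) of the worst-case errors over all positive rules with $N$ nodes. With $\mathbb{N}=\{1,2,\ldots\}$ and $\varepsilon\in(0,1)$ put $$N(\varepsilon,d)=\min\{N\in\mathbb{N}:e(N,d)\le\varepsilon\,e(0,d)\}.$$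 The problem is called - weakly tractable if $\lim_{d+\varepsilon^{-1}\to\infty}\frac{\log N(\varepsilon,d)}{d+\varepsilon^{-1}}=0$; - polynomially tractable if there are $C,\sigma>0$ and $\tau\ge0$ with $N(\varepsilon,d)\le Cd^\tau\varepsilon^{-\sigma}$ for all $\varepsilon\in(0,1)$, $d\in\mathbb{N}$; - strongly polynomially tractable if there are $C,\sigma>0$ with $N(\varepsilon,d)\le C\varepsilon^{-\sigma}$ for all $\varepsilon\in(0,1)$, $d\in\mathbb{N}$. *)

theory Defs
  imports "HOL-Analysis.Analysis" "HOL-Computational_Algebra.Polynomial"
begin

definition Lq_norm :: "real \<Rightarrow> (real \<Rightarrow> real) \<Rightarrow> real" where
  "Lq_norm q f = (LINT x:{0..1}|lborel. \<bar>f x\<bar> powr q) powr (1 / q)"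

definition P2 :: "real poly set" where
  "P2 = {p. degree p \<le> 2}"

definition P2_norm :: "real \<Rightarrow> real \<Rightarrow> real poly \<Rightarrow> real" where
  "P2_norm q g p =
     (Lq_norm q (poly p) powr q
        + 1 / g * (Lq_norm q (poly (pderiv p)) powr q
                   + Lq_norm q (poly (pderiv (pderiv p))) powr q)) powr (1 / q)"

definition cube :: "nat \<Rightarrow> (nat \<Rightarrow> real) set" where
  "cube d = {1..d} \<rightarrow>\<^sub>E {0..1}"

text \<open>A polynomial is determined by its values on the cube, so the elements of the tensor
  product are represented by polynomial functions of the coordinates \<open>1, \<dots>, d\<close> of an arbitrary
  point; this makes addition, scaling and zero the plain pointwise ones.\<close>

definition tensor_P2 :: "nat \<Rightarrow> ((nat \<Rightarrow> real) \<Rightarrow> real) set" where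
  "tensor_P2 d =
     {f. \<exists>c. f = (\<lambda>x. \<Sum>\<alpha>\<in>{1..d} \<rightarrow>\<^sub>E {..2::nat}. c \<alpha> * (\<Prod>j\<in>{1..d}. x j ^ \<alpha> j))}"

definition is_norm_on :: "('a \<Rightarrow> real) set \<Rightarrow> (('a \<Rightarrow> real) \<Rightarrow> real) \<Rightarrow> bool" where
  "is_norm_on V nrm \<longleftrightarrow>
     (\<forall>f\<in>V. 0 \<le> nrm f \<and> (nrm f = 0 \<longleftrightarrow> f = (\<lambda>_. 0))) \<and>
     (\<forall>f\<in>V. \<forall>c. nrm (\<lambda>x. c * f x) = \<bar>c\<bar> * nrm f) \<and>
     (\<forall>f\<in>V. \<forall>g\<in>V. nrm (\<lambda>x. f x + g x) \<le> nrm f + nrm g)"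

definition is_crossnorm ::
    "real \<Rightarrow> (nat \<Rightarrow> real) \<Rightarrow> nat \<Rightarrow> (((nat \<Rightarrow> real) \<Rightarrow> real) \<Rightarrow> real) \<Rightarrow> bool" where
  "is_crossnorm q \<gamma> d nrm \<longleftrightarrow>
     is_norm_on (tensor_P2 d) nrm \<and>
     (\<forall>p. (\<forall>j\<in>{1..d}. p j \<in> P2) \<longrightarrow>
        nrm (\<lambda>x. \<Prod>j\<in>{1..d}. poly (p j) (x j)) = (\<Prod>j\<in>{1..d}. P2_norm q (\<gamma> j) (p j)))"

definition cube_integral :: "nat \<Rightarrow> ((nat \<Rightarrow> real) \<Rightarrow> real) \<Rightarrow> real" where
  "cube_integral d f = (LINT x:cube d|Pi\<^sub>M {1..d} (\<lambda>_. lborel). f x)"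

text \<open>Suprema and infima of errors are formed in \<^typ>\<open>ereal\<close>, where they always exist.\<close>

definition initial_error :: "(((nat \<Rightarrow> real) \<Rightarrow> real) \<Rightarrow> real) \<Rightarrow> nat \<Rightarrow> ereal" where
  "initial_error nrm d = (SUP f\<in>{f \<in> tensor_P2 d. nrm f \<le> 1}. ereal \<bar>cube_integral d f\<bar>)"

definition is_worst_case_function ::
    "(((nat \<Rightarrow> real) \<Rightarrow> real) \<Rightarrow> real) \<Rightarrow> nat \<Rightarrow> ((nat \<Rightarrow> real) \<Rightarrow> real) \<Rightarrow> bool" where
  "is_worst_case_function nrm d f \<longleftrightarrow>
     f \<in> tensor_P2 d \<and> nrm f \<le> 1 \<and> ereal \<bar>cube_integral d f\<bar> = initial_error nrm d"

definition quadrature ::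
    "nat \<Rightarrow> (nat \<Rightarrow> real) \<Rightarrow> (nat \<Rightarrow> nat \<Rightarrow> real) \<Rightarrow> ((nat \<Rightarrow> real) \<Rightarrow> real) \<Rightarrow> real" where
  "quadrature N a x f = (\<Sum>k\<in>{1..N}. a k * f (x k))"

definition worst_case_error ::
    "(((nat \<Rightarrow> real) \<Rightarrow> real) \<Rightarrow> real) \<Rightarrow> nat \<Rightarrow> nat \<Rightarrow> (nat \<Rightarrow> real) \<Rightarrow> (nat \<Rightarrow> nat \<Rightarrow> real) \<Rightarrow> ereal" where
  "worst_case_error nrm d N a x =
     (SUP f\<in>{f \<in> tensor_P2 d. nrm f \<le> 1}. ereal \<bar>cube_integral d f - quadrature N a x f\<bar>)"

definition positive_rules :: "nat \<Rightarrow> nat \<Rightarrow> ((nat \<Rightarrow> real) \<times> (nat \<Rightarrow> nat \<Rightarrow> real)) set" where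
  "positive_rules d N = {(a, x). \<forall>k\<in>{1..N}. 0 \<le> a k \<and> x k \<in> cube d}"

definition min_error :: "(((nat \<Rightarrow> real) \<Rightarrow> real) \<Rightarrow> real) \<Rightarrow> nat \<Rightarrow> nat \<Rightarrow> ereal" where
  "min_error nrm N d = (INF (a, x)\<in>positive_rules d N. worst_case_error nrm d N a x)"

lemma min_error_0: "min_error nrm 0 d = initial_error nrm d"
  by (simp add: min_error_def initial_error_def worst_case_error_def positive_rules_def
      quadrature_def)

text \<open>The family \<open>nrm\<close> gives the norm \<open>nrm d\<close> on the \<open>d\<close>-variate space. The minimum exists for
  crossnorms because a tensor product of two-point Gauss rules integrates every element of the
  space exactly.\<close>

definition info_complexity ::
    "(nat \<Rightarrow> ((nat \<Rightarrow> real) \<Rightarrow> real) \<Rightarrow> real) \<Rightarrow> real \<Rightarrow> nat \<Rightarrow> nat" where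
  "info_complexity nrm \<epsilon> d =
     (LEAST N. 1 \<le> N \<and> min_error (nrm d) N d \<le> ereal \<epsilon> * initial_error (nrm d) d)"

text \<open>The filter expresses \<open>d + 1/\<epsilon> \<rightarrow> \<infinity>\<close> along \<open>\<epsilon> \<in> (0,1)\<close>, \<open>d \<ge> 1\<close>.\<close>

definition weakly_tractable :: "(real \<Rightarrow> nat \<Rightarrow> nat) \<Rightarrow> bool" where
  "weakly_tractable n \<longleftrightarrow>
     ((\<lambda>(\<epsilon>, d). ln (real (n \<epsilon> d)) / (real d + 1 / \<epsilon>)) \<longlongrightarrow> 0)
       (inf (filtercomap (\<lambda>(\<epsilon>, d). real d + 1 / \<epsilon>) at_top)
            (principal ({0<..<1} \<times> {1..})))"

definition polynomially_tractable :: "(real \<Rightarrow> nat \<Rightarrow> nat) \<Rightarrow> bool" where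
  "polynomially_tractable n \<longleftrightarrow>
     (\<exists>C \<sigma> \<tau>. 0 < C \<and> 0 < \<sigma> \<and> 0 \<le> \<tau> \<and>
        (\<forall>\<epsilon>\<in>{0<..<1}. \<forall>d\<ge>1. real (n \<epsilon> d) \<le> C * real d powr \<tau> * \<epsilon> powr - \<sigma>))"

definition strongly_polynomially_tractable :: "(real \<Rightarrow> nat \<Rightarrow> nat) \<Rightarrow> bool" where
  "strongly_polynomially_tractable n \<longleftrightarrow>
     (\<exists>C \<sigma>. 0 < C \<and> 0 < \<sigma> \<and>
        (\<forall>\<epsilon>\<in>{0<..<1}. \<forall>d\<ge>1. real (n \<epsilon> d) \<le> C * \<epsilon> powr - \<sigma>))"

end

theory Submission
  imports Defs "HOL-Real_Asymp.Real_Asymp"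
begin

text \<open>
  Around a point \<open>t\<close> the univariate space contains the polynomial \<open>1 - c (x - t)\<^sup>2\<close>, which is
  nonnegative on the unit interval and equals 1 at \<open>t\<close>, but for a suitable \<open>c\<close> has norm at most
  \<open>(1 + \<delta> \<rho>) powr (- 1 / q)\<close>. Let \<open>h\<close> be the product of these polynomials around a node of a
  positive rule \<open>A\<close> with error \<open>e\<close>, normalised to \<open>h / B\<close> in the unit ball. Since all terms of
  \<open>A(h / B)\<close> are nonnegative, the weight of that node is at most \<open>(1 + e) B\<close>; the constant
  function 1 shows that the weights add up to at least \<open>1 - e\<close>. Hence at least
  \<open>(1 - e) / ((1 + e) B)\<close> nodes are needed. The three consequences use only \<open>\<epsilon> = 1 / 4\<close>.
\<close>

section \<open>Integrals over the unit interval\<close>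

lemma set_lebesgue_integral_unit_interval:
  fixes f :: "real \<Rightarrow> real"
  assumes "continuous_on {0..1} f" "(f has_integral I) {0..1}"
  shows "(LINT x:{0..1}|lborel. f x) = I"
  using set_borel_integral_eq_integral(2)[OF borel_integrable_atLeastAtMost'[OF assms(1)]]
    integral_unique[OF assms(2)] by simp

text \<open>The number \<open>x - t\<close> is the difference of the nonnegative numbers
  \<open>(1 - t) * x\<close> and \<open>t * (1 - x)\<close>, so its absolute value is at most their
  sum, a convex combination of \<open>x\<close> and \<open>1 - x\<close>. Convexity of the power
  does the rest.\<close>

lemma convex_comb_powr_le:
  fixes x t q :: real
  assumes x: "x \<in> {0..1}" and t: "t \<in> {0..1}" and q: "1 < q"
  shows "\<bar>x - t\<bar> powr q \<le> (1 - t) * x powr q + t * (1 - x) powr q"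
proof -
  have le: "s powr q \<le> s" if "s \<in> {0..1}" for s :: real
    using powr_mono'[of 1 q s] that q by auto
  \<comment> \<open>Convexity is applied at \<open>x\<close> and \<open>1 - x\<close>, which are
    both positive only in the open interval. At the endpoints the claim reduces to
    \<open>s powr q \<le> s\<close>.\<close>
  consider "x = 0" | "x = 1" | "0 < x" "x < 1" using x by fastforce
  then show ?thesis
  proof cases
    case 1
    then show ?thesis using le[OF t] t q by (simp add: abs_minus_commute)
  next
    case 2
    then show ?thesis using le[of "1 - t"] t q by (simp add: abs_minus_commute)
  next
    case 3
    have "\<bar>x - t\<bar> \<le> (1 - t) * x + t * (1 - x)"
    proof -
      have "0 \<le> (1 - t) * x" "0 \<le> t * (1 - x)" using x t by auto
      moreover have "x - t = (1 - t) * x - t * (1 - x)" by (simp add: algebra_simps)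
      ultimately show ?thesis by linarith
    qed
    then have "\<bar>x - t\<bar> powr q \<le> ((1 - t) * x + t * (1 - x)) powr q"
      using q by (intro powr_mono2) auto
    also have "\<dots> \<le> (1 - t) * x powr q + t * (1 - x) powr q"
      using convex_onD[OF powr_convex[of q], of t x "1 - x"] t 3 q by simp
    finally show ?thesis .
  qed
qed

text \<open>In the pointwise bound both powers integrate to \<open>1 / (q + 1)\<close>, and the
  weights \<open>1 - t\<close> and \<open>t\<close> add up to 1. The resulting bound is uniform in
  the centre \<open>t\<close>.\<close>

lemma LINT_abs_diff_powr_le:
  fixes t q :: real
  assumes t: "t \<in> {0..1}" and q: "1 < q"
  shows "(LINT x:{0..1}|lborel. \<bar>x - t\<bar> powr q) \<le> 1 / (q + 1)"
proof -
  have cont: "continuous_on {0..1} (\<lambda>x::real. (1 - t) * x powr q + t * (1 - x) powr q)"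
    using q by (intro continuous_intros continuous_on_powr') auto
  have i: "((\<lambda>x::real. x powr q) has_integral 1 / (q + 1)) {0..1}"
    using has_integral_powr_from_0[of q 1] q by simp
  have "((\<lambda>x::real. (1 - x) powr q) has_integral 1 / (q + 1)) {0..1}"
    using has_integral_affinity[OF i[folded cbox_interval], of "-1" 1]
    by (simp add: image_affinity_atLeastAtMost_diff cbox_interval)
  then have "((\<lambda>x::real. (1 - t) * x powr q + t * (1 - x) powr q) has_integral
      (1 - t) * (1 / (q + 1)) + t * (1 / (q + 1))) {0..1}"
    by (intro has_integral_add has_integral_mult_right i)
  from set_lebesgue_integral_unit_interval[OF cont this]
  have eq: "(LINT x:{0..1}|lborel. (1 - t) * x powr q + t * (1 - x) powr q) = 1 / (q + 1)"
    by (simp only: distrib_right[symmetric]) simp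
  have "(LINT x:{0..1}|lborel. \<bar>x - t\<bar> powr q)
      \<le> (LINT x:{0..1}|lborel. (1 - t) * x powr q + t * (1 - x) powr q)"
    using q t convex_comb_powr_le[OF _ t q]
    by (intro set_integral_mono borel_integrable_atLeastAtMost' cont
        continuous_intros continuous_on_powr') auto
  then show ?thesis using eq by simp
qed

section \<open>The univariate norm and the peak polynomials\<close>

lemma Lq_norm_powr:
  assumes "q \<noteq> 0"
  shows "Lq_norm q f powr q = (LINT x:{0..1}|lborel. \<bar>f x\<bar> powr q)"
proof -
  have "0 \<le> (LINT x:{0..1}|lborel. \<bar>f x\<bar> powr q)"
    unfolding set_lebesgue_integral_def by (intro integral_nonneg_AE) auto
  then show ?thesis using assms by (simp add: Lq_norm_def powr_powr)
qed

lemma P2_norm_nonneg: "0 \<le> P2_norm q g p"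
  by (simp add: P2_norm_def)

definition bump :: "real \<Rightarrow> real \<Rightarrow> real poly" where
  "bump c t = [:1 - c * t\<^sup>2, 2 * c * t, - c:]"

lemma poly_bump: "poly (bump c t) x = 1 - c * (x - t)\<^sup>2"
  by (simp add: bump_def power2_eq_square algebra_simps)

lemma poly_bump_unit_interval:
  assumes "x \<in> {0..1}" "t \<in> {0..1}" "0 \<le> c" "c \<le> 1"
  shows "poly (bump c t) x \<in> {0..1}"
proof -
  have "\<bar>x - t\<bar> \<le> 1" using assms by auto
  then have "(x - t)\<^sup>2 \<le> 1" by (simp add: abs_square_le_1)
  then have "c * (x - t)\<^sup>2 \<le> 1" using assms by (intro mult_le_one) auto
  then show ?thesis using assms by (simp add: poly_bump)
qed

lemma bump_in_P2: "bump c t \<in> P2"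
  by (simp add: bump_def P2_def)

lemma poly_pderiv_bump: "poly (pderiv (bump c t)) x = 2 * c * (t - x)"
  by (simp add: bump_def pderiv_pCons algebra_simps)

lemma poly_pderiv2_bump: "poly (pderiv (pderiv (bump c t))) x = - 2 * c"
  by (simp add: bump_def pderiv_pCons)

text \<open>The mean of \<open>(x - t)\<^sup>2\<close> is the variance 1/12 of the uniform
  distribution plus \<open>(t - 1/2)\<^sup>2\<close>. So the midpoint is the worst centre, and 1/12
  is the constant that enters \<open>\<rho>\<close>.\<close>

lemma LINT_bump_le:
  assumes "0 \<le> c"
  shows "(LINT x:{0..1}|lborel. poly (bump c t) x) \<le> 1 - c / 12"
proof -
  \<comment> \<open>The antiderivative is \<open>x - c * (x - t)^3 / 3\<close>.\<close>
  have "((\<lambda>x. poly (bump c t) x) has_integral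
      (1 - c * (1 - t)^3 / 3) - (0 - c * (0 - t)^3 / 3)) {0..1}"
    by (intro fundamental_theorem_of_calculus)
      (auto simp: poly_bump power2_eq_square has_real_derivative_iff_has_vector_derivative[symmetric]
        intro!: derivative_eq_intros)
  then have "(LINT x:{0..1}|lborel. poly (bump c t) x) = 1 - c * (1 / 3 - t + t\<^sup>2)"
    by (subst set_lebesgue_integral_unit_interval)
      (auto simp: power2_eq_square power3_eq_cube field_simps intro!: continuous_intros)
  also have "\<dots> = 1 - c / 12 - c * (t - 1/2)\<^sup>2"
    by (simp add: power2_eq_square field_simps)
  also have "\<dots> \<le> 1 - c / 12" using assms by simp
  finally show ?thesis .
qed

text \<open>With \<open>c = u \<delta>\<close>, where \<open>\<delta> = g powr (1 / (q - 1))\<close>, both the gain \<open>c / 12\<close> in the function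
  part and the cost \<open>c powr q / g\<close> of the derivative part are of order \<open>\<delta>\<close>.\<close>

lemma P2_norm_bump_le:
  fixes g q u \<rho> :: real
  assumes g: "0 < g" "g \<le> 1" and q: "1 < q" and u: "0 < u" "u \<le> 1" and t: "t \<in> {0..1}"
    and rho: "\<rho> = u / 12 - (2 * u) powr q * ((q + 2) / (q + 1))"
  defines "\<delta> \<equiv> g powr (1 / (q - 1))"
  shows "P2_norm q g (bump (u * \<delta>) t) \<le> (1 - \<delta> * \<rho>) powr (1 / q)"
proof -
  define c where "c = u * \<delta>"
  have d: "0 < \<delta>" "\<delta> \<le> 1" using g q unfolding \<delta>_def by (auto intro: powr_le1)
  have c: "0 < c" "c \<le> 1" using d u unfolding c_def by (auto intro: mult_le_one)
  \<comment> \<open>The values lie in the unit interval, where the power \<open>q > 1\<close> does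
    not increase them. So the integral of the polynomial itself is an upper bound.\<close>
  have "\<bar>poly (bump c t) x\<bar> powr q \<le> poly (bump c t) x" if "x \<in> {0..1}" for x
    using poly_bump_unit_interval[OF that t, of c] powr_mono'[of 1 q "poly (bump c t) x"] c q
    by auto
  then have "Lq_norm q (poly (bump c t)) powr q \<le> (LINT x:{0..1}|lborel. poly (bump c t) x)"
    using q by (subst Lq_norm_powr)
      (auto intro!: set_integral_mono borel_integrable_atLeastAtMost' continuous_intros
        continuous_on_powr')
  also have "\<dots> \<le> 1 - c / 12" using c by (intro LINT_bump_le) auto
  finally have 1: "Lq_norm q (poly (bump c t)) powr q \<le> 1 - c / 12" .
  have "\<bar>2 * c * (t - x)\<bar> powr q = (2 * c) powr q * \<bar>x - t\<bar> powr q" for x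
    using c by (simp add: abs_mult powr_mult abs_minus_commute)
  then have "Lq_norm q (poly (pderiv (bump c t))) powr q
      = (2 * c) powr q * (LINT x:{0..1}|lborel. \<bar>x - t\<bar> powr q)"
    using q by (simp add: Lq_norm_powr poly_pderiv_bump)
  also have "\<dots> \<le> (2 * c) powr q * (1 / (q + 1))"
    by (intro mult_left_mono LINT_abs_diff_powr_le t q) auto
  finally have 2: "Lq_norm q (poly (pderiv (bump c t))) powr q \<le> (2 * c) powr q * (1 / (q + 1))" .
  have 3: "Lq_norm q (poly (pderiv (pderiv (bump c t)))) powr q = (2 * c) powr q"
    using q c by (simp add: Lq_norm_powr poly_pderiv2_bump set_lebesgue_integral_def)
  \<comment> \<open>This amounts to \<open>\<delta> powr (q - 1) = g\<close>, the equation behind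
    the choice of \<open>\<delta>\<close>: the factor \<open>1 / g\<close> then leaves the
    derivative cost linear in \<open>\<delta>\<close>.\<close>
  have "g * \<delta> = \<delta> powr q"
  proof -
    have "g * \<delta> = g powr (1 + 1 / (q - 1))" using g by (simp add: \<delta>_def powr_add)
    also have "1 + 1 / (q - 1) = 1 / (q - 1) * q" using q by (simp add: field_simps)
    finally show ?thesis by (simp add: \<delta>_def powr_powr)
  qed
  then have 4: "(2 * c) powr q / g = \<delta> * (2 * u) powr q"
    using g u d by (simp add: c_def powr_mult field_simps)
  have "Lq_norm q (poly (bump c t)) powr q
        + 1 / g * (Lq_norm q (poly (pderiv (bump c t))) powr q
                   + Lq_norm q (poly (pderiv (pderiv (bump c t)))) powr q)
      \<le> 1 - c / 12 + 1 / g * ((2 * c) powr q * (1 / (q + 1)) + (2 * c) powr q)"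
    using 1 2 3 g by (intro add_mono mult_left_mono) auto
  \<comment> \<open>The factor \<open>(q + 2) / (q + 1)\<close> is \<open>1 / (q + 1)\<close> from
    the first derivative plus 1 from the second.\<close>
  also have "1 / g * ((2 * c) powr q * (1 / (q + 1)) + (2 * c) powr q)
      = (2 * c) powr q / g * ((q + 2) / (q + 1))"
    using q g by (simp add: field_simps)
  also have "1 - c / 12 + \<dots> = 1 - \<delta> * \<rho>"
    unfolding rho 4 unfolding c_def by (simp add: algebra_simps)
  finally show ?thesis
    unfolding P2_norm_def c_def[symmetric] using q g
    by (intro powr_mono2) auto
qed

text \<open>Since \<open>2 powr q * ((q + 2) / (q + 1)) * B\<close> is 1/12, multiplying
  \<open>u powr (q - 1) < B\<close> by \<open>u\<close> makes the cost in \<open>\<rho>\<close>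
  smaller than the gain \<open>u / 12\<close>. Of the upper bounds, \<open>u < 1\<close> keeps the
  peaks nonnegative and \<open>\<rho> < 1\<close> keeps the norm bounds
  \<open>1 - \<delta> * \<rho>\<close> positive.\<close>

lemma rho_bounds:
  fixes q u \<rho> :: real
  assumes q: "1 < q" and u_pos: "0 < u"
    and u_less: "u < (1 / (12 * 2 powr q) * ((q + 1) / (q + 2))) powr (1 / (q - 1))"
    and rho: "\<rho> = u / 12 - (2 * u) powr q * ((q + 2) / (q + 1))"
  shows "u < 1" "0 < \<rho>" "\<rho> < 1"
proof -
  define B where "B = 1 / (12 * 2 powr q) * ((q + 1) / (q + 2))"
  have B: "0 < B" using q by (simp add: B_def)
  have "1 \<le> 2 powr q" using q by (simp add: ge_one_powr_ge_zero)
  then have "1 / (12 * 2 powr q) \<le> 1" by (simp add: field_simps)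
  moreover have "(q + 1) / (q + 2) \<le> 1" using q by simp
  ultimately have "B \<le> 1" unfolding B_def using q by (intro mult_le_one) auto
  then have "B powr (1 / (q - 1)) \<le> 1" using B q by (intro powr_le1) auto
  with u_less show u1: "u < 1" by (simp add: B_def)
  have "u powr (q - 1) < (B powr (1 / (q - 1))) powr (q - 1)"
    using u_less u_pos q by (intro powr_less_mono2) (auto simp: B_def)
  also have "\<dots> = B" using q B by (simp add: powr_powr)
  finally have "u powr (q - 1) < B" .
  then have "u * u powr (q - 1) < u * B" using u_pos by simp
  also have "u * u powr (q - 1) = u powr q"
    using u_pos by (simp add: powr_diff)
  finally have "u powr q < u * B" .
  then have "2 powr q * ((q + 2) / (q + 1)) * u powr q < 2 powr q * ((q + 2) / (q + 1)) * (u * B)"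
    using q by (intro mult_strict_left_mono) auto
  also have "\<dots> = u / 12" unfolding B_def using q by (simp add: divide_simps)
  finally show "0 < \<rho>" unfolding rho using u_pos by (simp add: powr_mult mult_ac)
  have "0 \<le> (2 * u) powr q * ((q + 2) / (q + 1))" using q by simp
  then show "\<rho> < 1" unfolding rho using u1 by linarith
qed

section \<open>Tensor products and integrals over the cube\<close>

lemma prod_poly_in_tensor_P2:
  assumes "\<And>j. j \<in> {1..d} \<Longrightarrow> p j \<in> P2"
  shows "(\<lambda>x. \<Prod>j\<in>{1..d}. poly (p j) (x j)) \<in> tensor_P2 d"
proof -
  \<comment> \<open>Padding with zero coefficients gives every factor the same exponent range, so
    that multiplying out produces exactly the index set of \<open>tensor_P2\<close>.\<close>
  have p: "poly r y = (\<Sum>i\<in>{..2}. coeff r i * y ^ i)" if "r \<in> P2" for r y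
    unfolding poly_altdef using that
    by (intro sum.mono_neutral_left) (auto simp: P2_def coeff_eq_0)
  have "(\<Prod>j\<in>{1..d}. poly (p j) (x j))
      = (\<Sum>\<alpha>\<in>{1..d} \<rightarrow>\<^sub>E {..2::nat}. (\<Prod>j\<in>{1..d}. coeff (p j) (\<alpha> j)) * (\<Prod>j\<in>{1..d}. x j ^ \<alpha> j))"
    for x
    using assms by (simp add: p prod_sum_PiE prod.distrib)
  then show ?thesis unfolding tensor_P2_def by auto
qed

lemma tensor_P2_scale:
  assumes "f \<in> tensor_P2 d"
  shows "(\<lambda>x. c * f x) \<in> tensor_P2 d"
proof -
  obtain b where f: "f = (\<lambda>x. \<Sum>\<alpha>\<in>{1..d} \<rightarrow>\<^sub>E {..2::nat}. b \<alpha> * (\<Prod>j\<in>{1..d}. x j ^ \<alpha> j))"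
    using assms by (auto simp: tensor_P2_def)
  show ?thesis unfolding tensor_P2_def f
    by (auto simp: sum_distrib_left mult.assoc intro!: exI[of _ "\<lambda>\<alpha>. c * b \<alpha>"])
qed

text \<open>On the product space the indicator of the cube is the product of the coordinate
  indicators, so Fubini's theorem for product functions applies.\<close>

lemma cube_prod_integral:
  fixes f :: "nat \<Rightarrow> real \<Rightarrow> real"
  assumes "\<And>j. j \<in> {1..d} \<Longrightarrow> set_integrable lborel {0..1} (f j)"
  shows "set_integrable (Pi\<^sub>M {1..d} (\<lambda>_. lborel)) (cube d) (\<lambda>x. \<Prod>j\<in>{1..d}. f j (x j))"
    and "cube_integral d (\<lambda>x. \<Prod>j\<in>{1..d}. f j (x j)) = (\<Prod>j\<in>{1..d}. LINT x:{0..1}|lborel. f j x)"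
proof -
  interpret product_sigma_finite "\<lambda>_::nat. lborel :: real measure" ..
  have eq: "indicator (cube d) x *\<^sub>R (\<Prod>j\<in>{1..d}. f j (x j))
      = (\<Prod>j\<in>{1..d}. indicator {0..1} (x j) *\<^sub>R f j (x j))"
    if "x \<in> space (Pi\<^sub>M {1..d} (\<lambda>_. lborel))" for x
  proof (cases "x \<in> cube d")
    case True
    then show ?thesis by (auto simp: cube_def PiE_iff)
  next
    case False
    \<comment> \<open>Points of the product space are extensional, so a point outside the cube must
      have a coordinate outside the interval, which gives a zero factor.\<close>
    moreover have "x \<in> extensional {1..d}" using that by (simp add: space_PiM PiE_iff)
    ultimately obtain i where "i \<in> {1..d}" "x i \<notin> {0..1}"
      unfolding cube_def PiE_iff by blast
    then have "(\<Prod>j\<in>{1..d}. indicator {0..1} (x j) *\<^sub>R f j (x j)) = 0"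
      by (intro prod_zero) (auto intro!: bexI[of _ i])
    then show ?thesis using False by simp
  qed
  have int: "\<And>j. j \<in> {1..d} \<Longrightarrow> integrable lborel (\<lambda>y. indicator {0..1} y *\<^sub>R f j y)"
    using assms by (simp add: set_integrable_def)
  show "set_integrable (Pi\<^sub>M {1..d} (\<lambda>_. lborel)) (cube d) (\<lambda>x. \<Prod>j\<in>{1..d}. f j (x j))"
    unfolding set_integrable_def
    using product_integrable_prod[OF finite_atLeastAtMost int]
    by (subst Bochner_Integration.integrable_cong[OF refl eq])
  show "cube_integral d (\<lambda>x. \<Prod>j\<in>{1..d}. f j (x j)) = (\<Prod>j\<in>{1..d}. LINT x:{0..1}|lborel. f j x)"
    unfolding cube_integral_def set_lebesgue_integral_def
    using product_integral_prod[OF finite_atLeastAtMost int]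
    by (subst Bochner_Integration.integral_cong[OF refl eq])
qed

lemma cube_integral_one: "cube_integral d (\<lambda>x. 1) = 1"
  using cube_prod_integral(2)[of d "\<lambda>_ _. 1"]
  by (simp add: borel_integrable_atLeastAtMost' set_lebesgue_integral_def)

section \<open>An exact positive rule and the attained complexity\<close>

lemma LINT_power_unit_interval: "(LINT x:{0..1}|lborel. x ^ n) = 1 / (real n + 1)"
  using integral_power[of 0 1 n] by (simp add: set_lebesgue_integral_def mult.commute)

text \<open>Tensor product of Simpson's rule. Without such a rule the \<open>LEAST\<close> in
  \<^const>\<open>info_complexity\<close> could range over an empty set.\<close>

lemma exact_positive_rule:
  obtains N a x where "1 \<le> N" "(a, x) \<in> positive_rules d N"
    "\<And>f. f \<in> tensor_P2 d \<Longrightarrow> quadrature N a x f = cube_integral d f"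
proof -
  \<comment> \<open>Simpson weights: 2/3 at the midpoint, 1/6 at both ends.\<close>
  define w :: "real \<Rightarrow> real" where "w y = (if y = 1/2 then 2/3 else 1/6)" for y
  define Y :: "real set" where "Y = {0, 1/2, 1}"
  define P where "P = {1..d} \<rightarrow>\<^sub>E Y"
  have fin: "finite P" unfolding P_def Y_def by (intro finite_PiE) auto
  have ne: "P \<noteq> {}" unfolding P_def Y_def by (simp add: PiE_eq_empty_iff)
  obtain x where x: "bij_betw x {1..card P} P"
    using ex_bij_betw_nat_finite_1[OF fin] by auto
  define a where "a k = (\<Prod>j\<in>{1..d}. w (x k j))" for k
  \<comment> \<open>Moments up to degree 2 suffice, because every exponent in
    \<open>tensor_P2 d\<close> is at most 2.\<close>
  have mom: "(\<Sum>y\<in>Y. w y * y ^ n) = 1 / (real n + 1)" if "n \<le> 2" for n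
    using that by (cases n; cases "n - 1") (auto simp: Y_def w_def power_divide)
  show thesis
  proof (rule that)
    show "1 \<le> card P" using fin ne by (simp add: Suc_le_eq card_gt_0_iff)
    have "x k \<in> cube d" if "k \<in> {1..card P}" for k
    proof -
      have "x k \<in> P" using x that by (auto simp: bij_betw_def)
      then show ?thesis by (auto simp: P_def Y_def cube_def PiE_iff)
    qed
    then show "(a, x) \<in> positive_rules d (card P)"
      by (auto simp: positive_rules_def a_def w_def intro!: prod_nonneg)
  next
    fix f assume "f \<in> tensor_P2 d"
    then obtain c where f: "f = (\<lambda>x. \<Sum>\<alpha>\<in>{1..d} \<rightarrow>\<^sub>E {..2::nat}. c \<alpha> * (\<Prod>j\<in>{1..d}. x j ^ \<alpha> j))"
      by (auto simp: tensor_P2_def)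
    have int: "set_integrable lborel {0..1} (\<lambda>y::real. y ^ n)" for n
      by (intro borel_integrable_atLeastAtMost' continuous_intros)
    \<comment> \<open>The sum over node numbers becomes a sum over the grid. Swapping sums and
      factoring over the coordinates then leaves one univariate moment per coordinate.\<close>
    have "quadrature (card P) a x f = (\<Sum>y\<in>P. (\<Prod>j\<in>{1..d}. w (y j)) * f y)"
      unfolding quadrature_def a_def by (rule sum.reindex_bij_betw[OF x])
    also have "\<dots> = (\<Sum>\<alpha>\<in>{1..d} \<rightarrow>\<^sub>E {..2::nat}. \<Sum>y\<in>P. c \<alpha> * (\<Prod>j\<in>{1..d}. w (y j) * y j ^ \<alpha> j))"
      unfolding f by (subst sum.swap) (simp add: sum_distrib_left prod.distrib mult_ac)
    also have "\<dots> = (\<Sum>\<alpha>\<in>{1..d} \<rightarrow>\<^sub>E {..2::nat}. c \<alpha> * (\<Prod>j\<in>{1..d}. \<Sum>y\<in>Y. w y * y ^ \<alpha> j))"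
      unfolding P_def by (subst prod_sum_PiE) (auto simp: sum_distrib_left Y_def)
    also have "\<dots> = (\<Sum>\<alpha>\<in>{1..d} \<rightarrow>\<^sub>E {..2::nat}. c \<alpha> * (\<Prod>j\<in>{1..d}. 1 / (real (\<alpha> j) + 1)))"
      by (intro sum.cong refl arg_cong2[where f = "(*)"] prod.cong mom) (auto simp: PiE_iff)
    also have "\<dots> = (\<Sum>\<alpha>\<in>{1..d} \<rightarrow>\<^sub>E {..2::nat}. c \<alpha> * cube_integral d (\<lambda>x. \<Prod>j\<in>{1..d}. x j ^ \<alpha> j))"
      by (subst cube_prod_integral(2)) (auto simp: int LINT_power_unit_interval)
    also have "\<dots> = cube_integral d f"
      unfolding f cube_integral_def set_lebesgue_integral_def scaleR_sum_right
      using cube_prod_integral(1)[OF int, of d]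
      by (subst Bochner_Integration.integral_sum) (auto simp: set_integrable_def mult.left_commute)
    finally show "quadrature (card P) a x f = cube_integral d f" .
  qed
qed

lemma initial_error_eq_1:
  assumes "is_worst_case_function nrm d (\<lambda>x. 1)"
  shows "initial_error nrm d = 1"
  using assms by (simp add: is_worst_case_function_def cube_integral_one one_ereal_def)

text \<open>The exact rule has error at most \<open>\<epsilon>\<close>, so the set under the
  \<open>LEAST\<close> is nonempty and its least element satisfies the defining inequality, in which
  the initial error is 1.\<close>

lemma info_complexity_attained:
  assumes wc: "is_worst_case_function (nrm d) d (\<lambda>x. 1)" and e: "0 < \<epsilon>"
  shows "min_error (nrm d) (info_complexity nrm \<epsilon> d) d \<le> ereal \<epsilon>"
proof -
  have ie: "initial_error (nrm d) d = 1" by (rule initial_error_eq_1[OF wc])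
  obtain N a x where N: "1 \<le> N" "(a, x) \<in> positive_rules d N"
    and ex: "\<And>f. f \<in> tensor_P2 d \<Longrightarrow> quadrature N a x f = cube_integral d f"
    using exact_positive_rule[of d] by metis
  have "min_error (nrm d) N d \<le> worst_case_error (nrm d) d N a x"
    unfolding min_error_def by (rule INF_lower2[OF N(2)]) simp
  also have "\<dots> \<le> ereal \<epsilon>"
    unfolding worst_case_error_def using ex e by (intro SUP_least) auto
  finally have "1 \<le> N \<and> min_error (nrm d) N d \<le> ereal \<epsilon> * initial_error (nrm d) d"
    using N ie by simp
  from LeastI[of "\<lambda>N. 1 \<le> N \<and> min_error (nrm d) N d \<le> ereal \<epsilon> * initial_error (nrm d) d", OF this]
  show ?thesis unfolding info_complexity_def ie by simp
qed

section \<open>Lower bounds on the number of nodes\<close>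

text \<open>The hypothesis \<open>fooling\<close> separates the counting argument from the
  construction of the peaks; \<open>B\<close> is a common bound on their norms.\<close>

lemma positive_rule_nodes_bound:
  assumes wc: "is_worst_case_function nrm d (\<lambda>x. 1)" and B: "0 < B"
    and fooling: "\<And>z. z \<in> cube d \<Longrightarrow> \<exists>h\<in>tensor_P2 d. nrm h \<le> B \<and> 1 \<le> h z \<and> (\<forall>x\<in>cube d. 0 \<le> h x)"
    and cn: "is_norm_on (tensor_P2 d) nrm"
    and rule: "(a, x) \<in> positive_rules d N"
    and err: "worst_case_error nrm d N a x \<le> ereal e"
  shows "1 - e \<le> real N * ((1 + e) * B)"
proof -
  have I: "\<bar>cube_integral d f\<bar> \<le> 1" if "f \<in> tensor_P2 d" "nrm f \<le> 1" for f
  proof -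
    have "ereal \<bar>cube_integral d f\<bar> \<le> initial_error nrm d"
      unfolding initial_error_def using that by (intro SUP_upper) auto
    then show ?thesis using initial_error_eq_1[OF wc] by simp
  qed
  have E: "\<bar>cube_integral d f - quadrature N a x f\<bar> \<le> e" if "f \<in> tensor_P2 d" "nrm f \<le> 1" for f
  proof -
    have "ereal \<bar>cube_integral d f - quadrature N a x f\<bar> \<le> worst_case_error nrm d N a x"
      unfolding worst_case_error_def using that by (intro SUP_upper) auto
    then have "ereal \<bar>cube_integral d f - quadrature N a x f\<bar> \<le> ereal e"
      using err by (rule order_trans)
    then show ?thesis by simp
  qed
  have a: "a k \<le> (1 + e) * B" if k: "k \<in> {1..N}" for k
  proof -
    have node: "\<And>i. i \<in> {1..N} \<Longrightarrow> 0 \<le> a i \<and> x i \<in> cube d"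
      using rule by (simp add: positive_rules_def)
    obtain h where h: "h \<in> tensor_P2 d" "nrm h \<le> B" "1 \<le> h (x k)" "\<And>y. y \<in> cube d \<Longrightarrow> 0 \<le> h y"
      using fooling[of "x k"] node[OF k] by blast
    define f where "f y = 1 / B * h y" for y
    have f: "f \<in> tensor_P2 d" unfolding f_def by (rule tensor_P2_scale[OF h(1)])
    have "nrm f = 1 / B * nrm h"
    proof -
      have "nrm (\<lambda>y. 1 / B * h y) = \<bar>1 / B\<bar> * nrm h"
        using cn h(1) unfolding is_norm_on_def by blast
      moreover have "f = (\<lambda>y. 1 / B * h y)" by (rule ext) (simp add: f_def)
      ultimately show ?thesis using B by simp
    qed
    then have nf: "nrm f \<le> 1" using h(2) B by (simp add: divide_le_eq)
    have "a k * (1 / B) \<le> a k * f (x k)"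
      unfolding f_def using node[OF k] h(3) B by (intro mult_left_mono) (auto simp: field_simps)
    also have "\<dots> \<le> quadrature N a x f"
      unfolding quadrature_def using node h(4) B k
      by (intro member_le_sum[where f = "\<lambda>k. a k * f (x k)"]) (auto simp: f_def)
    \<comment> \<open>The integral over the unit ball is at most the initial error 1, and the rule
      deviates from it by at most \<open>e\<close>.\<close>
    also have "\<dots> \<le> 1 + e" using I[OF f nf] E[OF f nf] by linarith
    finally show ?thesis using B by (simp add: field_simps)
  qed
  have one: "(\<lambda>x. 1) \<in> tensor_P2 d" "nrm (\<lambda>x. 1) \<le> 1"
    using wc by (auto simp: is_worst_case_function_def)
  have "1 - e \<le> (\<Sum>k\<in>{1..N}. a k)"
    using E[OF one] by (simp add: cube_integral_one quadrature_def)
  also have "\<dots> \<le> real N * ((1 + e) * B)"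
    using sum_bounded_above[of "{1..N}" a "(1 + e) * B"] a by simp
  finally show ?thesis .
qed

text \<open>The minimal error is an infimum, so a rule is picked with error below an arbitrary
  \<open>e > \<epsilon>\<close>, and then \<open>e\<close> tends to
  \<open>\<epsilon>\<close>.\<close>

lemma min_error_nodes_bound:
  assumes wc: "is_worst_case_function nrm d (\<lambda>x. 1)" and B: "0 < B"
    and fooling: "\<And>z. z \<in> cube d \<Longrightarrow> \<exists>h\<in>tensor_P2 d. nrm h \<le> B \<and> 1 \<le> h z \<and> (\<forall>x\<in>cube d. 0 \<le> h x)"
    and cn: "is_norm_on (tensor_P2 d) nrm"
    and err: "min_error nrm N d \<le> ereal \<epsilon>" and e: "0 < \<epsilon>"
  shows "(1 - 2 * \<epsilon>) / B \<le> real N"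
proof -
  have "1 - e \<le> real N * ((1 + e) * B)" if "\<epsilon> < e" for e
  proof -
    have "min_error nrm N d < ereal e" using err that by (simp add: le_less_trans)
    then obtain a x where "(a, x) \<in> positive_rules d N" "worst_case_error nrm d N a x < ereal e"
      unfolding min_error_def INF_less_iff by auto
    then show ?thesis
      using positive_rule_nodes_bound[OF wc B fooling cn] by (simp add: less_imp_le)
  qed
  \<comment> \<open>Solving for \<open>e\<close> puts the inequality into the form that
    \<open>dense_ge\<close> can pass to the limit.\<close>
  then have "\<epsilon> < e \<Longrightarrow> 1 - real N * B \<le> e * (1 + real N * B)" for e
    by (fastforce simp: algebra_simps)
  then have "\<epsilon> < e \<Longrightarrow> (1 - real N * B) / (1 + real N * B) \<le> e" for e
    using B by (simp add: divide_le_eq add_pos_nonneg)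
  then have "(1 - real N * B) / (1 + real N * B) \<le> \<epsilon>" by (rule dense_ge)
  then have *: "1 - \<epsilon> \<le> (1 + \<epsilon>) * (real N * B)"
    using B by (simp add: divide_le_eq add_pos_nonneg algebra_simps)
  \<comment> \<open>The left side is \<open>1 - \<epsilon> - 2 * \<epsilon>\<^sup>2\<close>; this
    replaces \<open>(1 - \<epsilon>) / (1 + \<epsilon>)\<close> by the simpler
    \<open>1 - 2 * \<epsilon>\<close>.\<close>
  have "(1 + \<epsilon>) * (1 - 2 * \<epsilon>) \<le> 1 - \<epsilon>" by (simp add: algebra_simps)
  with * have "(1 + \<epsilon>) * (1 - 2 * \<epsilon>) \<le> (1 + \<epsilon>) * (real N * B)" by linarith
  then have "1 - 2 * \<epsilon> \<le> real N * B" using e by (simp add: mult_le_cancel_left_pos)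
  then show ?thesis using B by (simp add: divide_le_eq)
qed

lemma info_complexity_lower_bound:
  fixes \<gamma> :: "nat \<Rightarrow> real" and q u \<rho> :: real
  assumes weights: "\<And>j. j \<ge> 1 \<Longrightarrow> 0 < \<gamma> j \<and> \<gamma> j \<le> 1"
    and q: "1 < q"
    and crossnorm: "is_crossnorm q \<gamma> d (nrm d)"
    and wc: "is_worst_case_function (nrm d) d (\<lambda>x. 1)"
    and u: "0 < u" "u \<le> 1"
    and rho: "\<rho> = u / 12 - (2 * u) powr q * ((q + 2) / (q + 1))"
    and rho01: "0 < \<rho>" "\<rho> < 1"
    and e: "0 < \<epsilon>" "\<epsilon> < 1 / 2"
  shows "(1 - 2 * \<epsilon>) * (\<Prod>j=1..d. (1 + \<gamma> j powr (1 / (q - 1)) * \<rho>) powr (1 / q))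
      \<le> real (info_complexity nrm \<epsilon> d)"
proof -
  define \<delta> where "\<delta> j = \<gamma> j powr (1 / (q - 1))" for j
  have d: "0 < \<delta> j" "\<delta> j \<le> 1" if "j \<ge> 1" for j
    using weights[OF that] q by (auto simp: \<delta>_def intro: powr_le1)
  have dr: "0 < \<delta> j * \<rho>" "\<delta> j * \<rho> < 1" if "j \<ge> 1" for j
    using d[OF that] rho01 mult_right_mono[of "\<delta> j" 1 \<rho>] by (simp_all, linarith)
  define B where "B = (\<Prod>j\<in>{1..d}. (1 - \<delta> j * \<rho>) powr (1 / q))"
  have B: "0 < B" unfolding B_def using dr by (intro prod_pos) fastforce
  have fool: "\<exists>h\<in>tensor_P2 d. nrm d h \<le> B \<and> 1 \<le> h z \<and> (\<forall>x\<in>cube d. 0 \<le> h x)"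
    if z: "z \<in> cube d" for z
  proof (intro bexI conjI ballI)
    let ?p = "\<lambda>j. bump (u * \<delta> j) (z j)"
    let ?h = "\<lambda>x. \<Prod>j\<in>{1..d}. poly (?p j) (x j)"
    have z1: "z j \<in> {0..1}" if "j \<in> {1..d}" for j using z that by (auto simp: cube_def PiE_iff)
    show "?h \<in> tensor_P2 d" by (intro prod_poly_in_tensor_P2 bump_in_P2)
    have "nrm d ?h = (\<Prod>j\<in>{1..d}. P2_norm q (\<gamma> j) (?p j))"
      using crossnorm bump_in_P2 unfolding is_crossnorm_def by simp
    also have "\<dots> \<le> B"
      unfolding B_def
    proof (intro prod_mono conjI P2_norm_nonneg)
      fix j assume j: "j \<in> {1..d}"
      then show "P2_norm q (\<gamma> j) (?p j) \<le> (1 - \<delta> j * \<rho>) powr (1 / q)"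
        unfolding \<delta>_def using weights[of j] z1[OF j] by (intro P2_norm_bump_le q u rho) auto
    qed
    finally show "nrm d ?h \<le> B" .
    show "1 \<le> ?h z" by (simp add: poly_bump)
    show "0 \<le> ?h x" if x: "x \<in> cube d" for x
    proof (intro prod_nonneg ballI)
      fix j assume j: "j \<in> {1..d}"
      then have "x j \<in> {0..1}" using x by (auto simp: cube_def PiE_iff)
      moreover have "u * \<delta> j \<le> 1" using d[of j] u j by (intro mult_le_one) auto
      ultimately show "0 \<le> poly (?p j) (x j)"
        using poly_bump_unit_interval[of "x j" "z j" "u * \<delta> j"] z1[OF j] u d[of j] j by auto
    qed
  qed
  have err: "min_error (nrm d) (info_complexity nrm \<epsilon> d) d \<le> ereal \<epsilon>"
    using wc e(1) by (rule info_complexity_attained)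
  have main: "(1 - 2 * \<epsilon>) / B \<le> real (info_complexity nrm \<epsilon> d)"
    using crossnorm unfolding is_crossnorm_def
    by (intro min_error_nodes_bound[OF wc B fool _ err e(1)]) auto
  \<comment> \<open>Because \<open>(1 + y) * (1 - y) \<le> 1\<close>, the reciprocal of
    \<open>B\<close> dominates the product in the claim.\<close>
  have "(\<Prod>j=1..d. (1 + \<delta> j * \<rho>) powr (1 / q)) * B
      = (\<Prod>j=1..d. ((1 + \<delta> j * \<rho>) * (1 - \<delta> j * \<rho>)) powr (1 / q))"
    unfolding B_def prod.distrib[symmetric]
    by (intro prod.cong refl powr_mult[symmetric])
  also have "\<dots> \<le> 1"
  proof (intro prod_le_1 conjI)
    fix j assume "j \<in> {1..d}"
    then have "0 < \<delta> j * \<rho>" "\<delta> j * \<rho> < 1" using dr by auto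
    then have "0 \<le> (1 + \<delta> j * \<rho>) * (1 - \<delta> j * \<rho>)" by simp
    moreover have "(1 + \<delta> j * \<rho>) * (1 - \<delta> j * \<rho>) = 1 - (\<delta> j * \<rho>)\<^sup>2"
      by (simp add: power2_eq_square algebra_simps)
    ultimately show "((1 + \<delta> j * \<rho>) * (1 - \<delta> j * \<rho>)) powr (1 / q) \<le> 1"
      using q by (intro powr_le1) auto
  qed simp
  finally have "(\<Prod>j=1..d. (1 + \<delta> j * \<rho>) powr (1 / q)) \<le> 1 / B"
    using B by (simp add: field_simps)
  then have "(1 - 2 * \<epsilon>) * (\<Prod>j=1..d. (1 + \<delta> j * \<rho>) powr (1 / q)) \<le> (1 - 2 * \<epsilon>) * (1 / B)"
    using e by (intro mult_left_mono) auto
  with main show ?thesis unfolding \<delta>_def by simp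
qed

section \<open>From the product bound to the tractability conditions\<close>

text \<open>This is \<open>ln (1 + y) \<le> y\<close> at \<open>y = - x / (1 + x)\<close>, where
  \<open>1 + y\<close> is the inverse of \<open>1 + x\<close>.\<close>

lemma ln_add_one_ge:
  fixes x :: real
  assumes "0 \<le> x"
  shows "x / (1 + x) \<le> ln (1 + x)"
proof -
  have "1 + - x / (1 + x) = inverse (1 + x)" using assms by (simp add: field_simps)
  moreover have "ln (inverse (1 + x)) = - ln (1 + x)" using assms by (simp add: ln_inverse)
  moreover have "- 1 < - x / (1 + x)" using assms by (simp add: field_simps)
  ultimately show ?thesis using ln_add_one_self_le_self2[of "- x / (1 + x)"] by simp
qed

text \<open>Each logarithm is at least a multiple of \<open>\<delta> j\<close>. Since
  \<open>\<delta> j \<le> 1\<close>, the denominator \<open>1 + \<delta> j * \<rho>\<close> is at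
  most \<open>1 + \<rho>\<close>, so the multiple is the same for all \<open>j\<close> and
  \<open>d\<close>.\<close>

lemma ln_prod_powr_ge:
  fixes \<delta> :: "nat \<Rightarrow> real" and q \<rho> :: real
  assumes "\<And>j. j \<ge> 1 \<Longrightarrow> 0 < \<delta> j \<and> \<delta> j \<le> 1" "0 < q" "0 < \<rho>"
  shows "\<rho> / (q * (1 + \<rho>)) * (\<Sum>j=1..d. \<delta> j) \<le> ln (\<Prod>j=1..d. (1 + \<delta> j * \<rho>) powr (1 / q))"
proof -
  have "\<rho> / (q * (1 + \<rho>)) * \<delta> j \<le> ln ((1 + \<delta> j * \<rho>) powr (1 / q))" if "j \<ge> 1" for j
  proof -
    have dj: "0 < \<delta> j" "\<delta> j \<le> 1" using assms(1)[OF that] by auto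
    then have "\<delta> j * \<rho> / (1 + \<rho>) \<le> \<delta> j * \<rho> / (1 + \<delta> j * \<rho>)"
      using assms(3) by (intro divide_left_mono) (auto intro!: mult_pos_pos add_pos_pos)
    also have "\<dots> \<le> ln (1 + \<delta> j * \<rho>)" using dj assms(3) by (intro ln_add_one_ge) auto
    finally have "1 / q * (\<delta> j * \<rho> / (1 + \<rho>)) \<le> 1 / q * ln (1 + \<delta> j * \<rho>)"
      using assms(2) by (intro mult_left_mono) auto
    moreover have "0 < 1 + \<delta> j * \<rho>" using dj assms(3) by (simp add: add_pos_pos)
    ultimately show ?thesis by (simp add: ln_powr mult_ac)
  qed
  then have "(\<Sum>j=1..d. \<rho> / (q * (1 + \<rho>)) * \<delta> j) \<le> (\<Sum>j=1..d. ln ((1 + \<delta> j * \<rho>) powr (1 / q)))"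
    by (intro sum_mono) auto
  also have "\<dots> = ln (\<Prod>j=1..d. (1 + \<delta> j * \<rho>) powr (1 / q))"
  proof (rule ln_prod[symmetric])
    fix j assume "j \<in> {1..d}"
    then have "0 < 1 + \<delta> j * \<rho>" using assms by (simp add: add_pos_pos)
    then show "(1 + \<delta> j * \<rho>) powr (1 / q) \<noteq> 0" by simp
  qed simp
  finally show ?thesis by (simp add: sum_distrib_left)
qed

theorem theorem7:
  fixes \<gamma> :: "nat \<Rightarrow> real" and q u \<rho> :: real
    and nrm :: "nat \<Rightarrow> ((nat \<Rightarrow> real) \<Rightarrow> real) \<Rightarrow> real"
  assumes weights: "\<And>j. j \<ge> 1 \<Longrightarrow> 0 < \<gamma> j \<and> \<gamma> j \<le> 1"
    and q: "1 < q"
    and crossnorm: "\<And>d. d \<ge> 1 \<Longrightarrow> is_crossnorm q \<gamma> d (nrm d)"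
    and worst_case: "\<And>d. d \<ge> 1 \<Longrightarrow> is_worst_case_function (nrm d) d (\<lambda>x. 1)"
    and u_pos: "0 < u"
    and u_less: "u < (1 / (12 * 2 powr q) * ((q + 1) / (q + 2))) powr (1 / (q - 1))"
    and rho: "\<rho> = u / 12 - (2 * u) powr q * ((q + 2) / (q + 1))"
  shows "0 < \<rho> \<and>
    (\<forall>\<epsilon>\<in>{0<..<1/2}. \<forall>d\<ge>1.
       real (info_complexity nrm \<epsilon> d) \<ge>
         (1 - 2 * \<epsilon>) * (\<Prod>j=1..d. (1 + \<gamma> j powr (1 / (q - 1)) * \<rho>) powr (1 / q))) \<and>
    (strongly_polynomially_tractable (info_complexity nrm) \<longrightarrow>
       summable (\<lambda>j. \<gamma> (Suc j) powr (1 / (q - 1)))) \<and>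
    (polynomially_tractable (info_complexity nrm) \<longrightarrow>
       limsup (\<lambda>d. ereal (1 / ln (real d) * (\<Sum>j=1..d. \<gamma> j powr (1 / (q - 1))))) < \<infinity>) \<and>
    (weakly_tractable (info_complexity nrm) \<longrightarrow>
       (\<lambda>d. 1 / real d * (\<Sum>j=1..d. \<gamma> j powr (1 / (q - 1)))) \<longlonglongrightarrow> 0)"
proof -
  define \<delta> where "\<delta> j = \<gamma> j powr (1 / (q - 1))" for j
  define n where "n d = real (info_complexity nrm (1 / 4) d)" for d
  define S where "S d = (\<Sum>j=1..d. \<delta> j)" for d
  define \<kappa> where "\<kappa> = \<rho> / (q * (1 + \<rho>))"
  note rho_facts = rho_bounds[OF q u_pos u_less rho]
  have \<kappa>: "0 < \<kappa>" using rho_facts q by (simp add: \<kappa>_def)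
  have \<delta>: "0 < \<delta> j \<and> \<delta> j \<le> 1" if "j \<ge> 1" for j
    using weights[OF that] q by (auto simp: \<delta>_def intro: powr_le1)
  have S0: "0 \<le> S d" for d unfolding S_def using \<delta> by (intro sum_nonneg) (auto intro: less_imp_le)
  have bound: "(1 - 2 * \<epsilon>) * (\<Prod>j=1..d. (1 + \<delta> j * \<rho>) powr (1 / q)) \<le> real (info_complexity nrm \<epsilon> d)"
    if "\<epsilon> \<in> {0<..<1/2}" "d \<ge> 1" for \<epsilon> d
    unfolding \<delta>_def using that rho_facts
    by (intro info_complexity_lower_bound[OF weights q crossnorm worst_case u_pos _ rho]) auto
  \<comment> \<open>At \<open>\<epsilon> = 1 / 4\<close> the factor
    \<open>1 - 2 * \<epsilon>\<close> is 1/2, whence the summand \<open>ln 2\<close>.\<close>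
  have n_pos: "0 < n d" and S_le: "\<kappa> * S d \<le> ln (n d) + ln 2" if "d \<ge> 1" for d
  proof -
    let ?P = "\<Prod>j=1..d. (1 + \<delta> j * \<rho>) powr (1 / q)"
    have "1 + \<delta> j * \<rho> \<noteq> 0" if "j \<in> {1..d}" for j
      using mult_pos_pos[of "\<delta> j" \<rho>] \<delta>[of j] rho_facts that by (smt (verit) atLeastAtMost_iff)
    then have P: "0 < ?P" by (intro prod_pos) auto
    have *: "?P / 2 \<le> n d" using bound[of "1/4" d] that by (simp add: n_def)
    then show n: "0 < n d" using P by linarith
    have "\<kappa> * S d \<le> ln ?P"
      unfolding \<kappa>_def S_def using \<delta> q rho_facts by (intro ln_prod_powr_ge) auto
    also have "\<dots> \<le> ln (2 * n d)" using P * n by (subst ln_le_cancel_iff) auto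
    also have "\<dots> = ln (n d) + ln 2" using n by (simp add: ln_mult)
    finally show "\<kappa> * S d \<le> ln (n d) + ln 2" .
  qed
  have spt: "summable (\<lambda>j. \<delta> (Suc j))" if spt_asm: "strongly_polynomially_tractable (info_complexity nrm)"
  proof -
    obtain C \<sigma> where C: "0 < C" "\<And>\<epsilon> d. \<epsilon> \<in> {0<..<1} \<Longrightarrow> d \<ge> 1 \<Longrightarrow>
        real (info_complexity nrm \<epsilon> d) \<le> C * \<epsilon> powr - \<sigma>"
      using spt_asm unfolding strongly_polynomially_tractable_def by blast
    define M where "M = C * (1 / 4) powr - \<sigma>"
    have M: "0 < M" using C(1) by (simp add: M_def)
    \<comment> \<open>Here \<open>n\<close> is bounded by the constant \<open>M\<close>, so the
      partial sums of the nonnegative terms are bounded.\<close>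
    have "(\<Sum>j\<le>m. norm (\<delta> (Suc j))) \<le> (ln M + ln 2) / \<kappa>" for m
    proof -
      have "n (Suc m) \<le> M" unfolding n_def M_def by (rule C(2)) auto
      then have "ln (n (Suc m)) \<le> ln M" using n_pos[of "Suc m"] by simp
      with S_le[of "Suc m"] have "\<kappa> * S (Suc m) \<le> ln M + ln 2" by simp
      moreover have "S (Suc m) = (\<Sum>j\<le>m. \<delta> (Suc j))"
        unfolding S_def using sum.atLeast_Suc_atMost_Suc_shift[of \<delta> 0 m]
        by (simp add: atLeast0AtMost)
      moreover have "\<dots> = (\<Sum>j\<le>m. norm (\<delta> (Suc j)))"
        using \<delta> by (intro sum.cong refl) (simp add: less_imp_le)
      ultimately show ?thesis using \<kappa> by (simp add: field_simps)
    qed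
    then have "summable (\<lambda>j. norm (\<delta> (Suc j)))"
      by (intro bounded_imp_summable[where B = "(ln M + ln 2) / \<kappa>"]) auto
    then show ?thesis by (rule summable_norm_cancel)
  qed
  have pt: "limsup (\<lambda>d. ereal (1 / ln (real d) * S d)) < \<infinity>"
    if pt_asm: "polynomially_tractable (info_complexity nrm)"
  proof -
    obtain C \<sigma> \<tau> where C: "0 < C" "0 \<le> \<tau>" "\<And>\<epsilon> d. \<epsilon> \<in> {0<..<1} \<Longrightarrow> d \<ge> 1 \<Longrightarrow>
        real (info_complexity nrm \<epsilon> d) \<le> C * real d powr \<tau> * \<epsilon> powr - \<sigma>"
      using pt_asm unfolding polynomially_tractable_def by blast
    define M where "M = C * (1 / 4) powr - \<sigma>"
    have M: "0 < M" using C(1) by (simp add: M_def)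
    define K where "K = (\<bar>ln M\<bar> + ln 2 + \<tau>) / \<kappa>"
    \<comment> \<open>From \<open>d = 3\<close> on, \<open>ln (real d) \<ge> 1\<close> because e is
      at most 3. Constants can then be absorbed into multiples of
      \<open>ln (real d)\<close>.\<close>
    have "1 / ln (real d) * S d \<le> K" if "d \<ge> 3" for d
    proof -
      have "exp 1 \<le> real d" using that exp_le by linarith
      then have l: "1 \<le> ln (real d)" using that by (subst ln_ge_iff) auto
      have "n d \<le> M * real d powr \<tau>"
        using C(3)[of "1/4" d] that by (simp add: n_def M_def mult_ac)
      then have "ln (n d) \<le> ln (M * real d powr \<tau>)" using n_pos[of d] that by simp
      also have "\<dots> = ln M + \<tau> * ln (real d)" using M that by (simp add: ln_mult ln_powr)
      finally have "\<kappa> * S d \<le> ln M + ln 2 + \<tau> * ln (real d)" using S_le[of d] that by simp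
      also have "\<dots> \<le> (\<bar>ln M\<bar> + ln 2) * ln (real d) + \<tau> * ln (real d)"
        using mult_left_mono[OF l, of "\<bar>ln M\<bar> + ln 2"] by simp
      finally have "S d \<le> K * ln (real d)"
        unfolding K_def using \<kappa> by (simp add: field_simps)
      then show ?thesis using l by (simp add: field_simps)
    qed
    then have "eventually (\<lambda>d. ereal (1 / ln (real d) * S d) \<le> ereal K) sequentially"
      unfolding eventually_sequentially by (intro exI[of _ 3]) auto
    then have "limsup (\<lambda>d. ereal (1 / ln (real d) * S d)) \<le> ereal K"
      by (rule Limsup_bounded)
    then show ?thesis by (rule le_less_trans) simp
  qed
  have wt: "(\<lambda>d. 1 / real d * S d) \<longlonglongrightarrow> 0" if wt_asm: "weakly_tractable (info_complexity nrm)"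
  proof -
    have "filterlim (\<lambda>d::nat. real d + 4) at_top sequentially"
      by real_asymp
    \<comment> \<open>Along the path with constant \<open>\<epsilon> = 1 / 4\<close> the quantity
      \<open>d + 1 / \<epsilon>\<close> is \<open>d + 4\<close> and tends to infinity, so the
      two-parameter limit restricts to this path.\<close>
    then have "filterlim (\<lambda>d::nat. (1 / 4 :: real, d))
       (inf (filtercomap (\<lambda>(\<epsilon>, d). real d + 1 / \<epsilon>) at_top) (principal ({0<..<1} \<times> {1..})))
       sequentially"
      unfolding filterlim_inf filterlim_principal filterlim_filtercomap_iff
      by (auto simp: o_def eventually_sequentially)
    from filterlim_compose[OF wt_asm[unfolded weakly_tractable_def] this]
    have 1: "(\<lambda>d. ln (n d) / (real d + 4)) \<longlonglongrightarrow> 0" by (simp add: n_def)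
    have 2: "(\<lambda>d. (real d + 4) / real d) \<longlonglongrightarrow> 1" by real_asymp
    have 3: "(\<lambda>d. ln 2 / real d) \<longlonglongrightarrow> 0" by real_asymp
    \<comment> \<open>This is the upper bound on \<open>S d / d\<close> from \<open>S_le\<close>;
      the second factor changes the normalisation from \<open>d + 4\<close> to
      \<open>d\<close>.\<close>
    have lim: "(\<lambda>d. (ln (n d) / (real d + 4) * ((real d + 4) / real d) + ln 2 / real d) / \<kappa>) \<longlonglongrightarrow> 0"
      using tendsto_divide[OF tendsto_add[OF tendsto_mult[OF 1 2] 3] tendsto_const[of \<kappa>]] \<kappa> by simp
    show ?thesis
    proof (rule tendsto_sandwich[OF _ _ tendsto_const lim])
      show "\<forall>\<^sub>F d in sequentially. 0 \<le> 1 / real d * S d"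
        using S0 by simp
      show "\<forall>\<^sub>F d in sequentially. 1 / real d * S d
          \<le> (ln (n d) / (real d + 4) * ((real d + 4) / real d) + ln 2 / real d) / \<kappa>"
        using eventually_ge_at_top[of 1]
      proof eventually_elim
        case (elim d)
        have "ln (n d) / (real d + 4) * ((real d + 4) / real d) = ln (n d) / real d" by simp
        moreover have "1 / real d * S d \<le> (ln (n d) / real d + ln 2 / real d) / \<kappa>"
          using S_le[OF elim] \<kappa> elim by (simp add: field_simps)
        ultimately show ?case by simp
      qed
    qed
  qed
  show ?thesis
    using rho_facts(2) bound spt pt wt unfolding \<delta>_def S_def by blast
qed

end
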